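(* Let $a<b$ be real numbers, let $q\in(0,1)$, and let $f:[a,b]\to\mathbb{R}$ be a $q$-integrable function over $[a,b]$. Then for every integer $m\ge 0$, $$\left| f\big(a+q^{m}(b-a)\big)-\frac{1}{b-a}\int_a^b f(t)\,d_q^a t\right| \le (b-a)\left(\frac{1+2q^{2m+1}}{1+q}-q^{m}\right)\left\|D_q^a f\right\|_\infty^{(a,b]}.$$
   Context: Let $f:[a,b]\to\mathbb{R}$ and $q\in(0,1)$. The (shifted) $q$-derivative of $f$ at $x\in(a,b]$ is $$D_q^a f(x)=\frac{f(x)-f(a+q(x-a))}{(1-q)(x-a)}.$$ The (shifted) $q$-integral is $$\int_a^b f(t)\,d_q^a t=(1-q)(b-a)\sum_{k=0}^\infty q^k f\big(a+q^k(b-a)\big),$$ and $f$ is called $q$-integrable over $[a,b]$ if this series converges. For a function $g$ defined on $(a,b]$, $\|g\|_\infty^{(a,b]}=\sup_{t\in(a,b]}|g(t)|\in[0,+\infty]$; if this is $+\infty$ the inequality is understood to hold trivially. *)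

theory Defs
  imports Complex_Main "HOL-Library.Extended_Real"
begin

(* A function on [a,b] is represented by a total function real => real. For 0 < q < 1 and
   x in (a,b], all points at which f is evaluated below lie in (a,b]. *)

definition q_deriv :: "real \<Rightarrow> real \<Rightarrow> (real \<Rightarrow> real) \<Rightarrow> real \<Rightarrow> real" where
  "q_deriv q a f x = (f x - f (a + q * (x - a))) / ((1 - q) * (x - a))"

definition q_integrable :: "real \<Rightarrow> real \<Rightarrow> real \<Rightarrow> (real \<Rightarrow> real) \<Rightarrow> bool" where
  "q_integrable q a b f \<longleftrightarrow> summable (\<lambda>k. q ^ k * f (a + q ^ k * (b - a)))"

definition q_integral :: "real \<Rightarrow> real \<Rightarrow> real \<Rightarrow> (real \<Rightarrow> real) \<Rightarrow> real" where
  "q_integral q a b f = (1 - q) * (b - a) * (\<Sum>k. q ^ k * f (a + q ^ k * (b - a)))"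

(* Extended-real valued, so that it is \<infinity> when g is unbounded on S; S is meant to be nonempty. *)
definition sup_norm_on :: "real set \<Rightarrow> (real \<Rightarrow> real) \<Rightarrow> ereal" where
  "sup_norm_on S g = (SUP t\<in>S. ereal \<bar>g t\<bar>)"

end

theory Submission
  imports Defs
begin

text \<open>
  Put \<open>x\<^sub>k = a + q\<^sup>k (b - a)\<close>. The weights \<open>(1 - q) q\<^sup>k\<close> sum to 1 and the normalised
  \<open>q\<close>-integral is the mean of the values \<open>f x\<^sub>k\<close> with these weights. A bound \<open>M\<close> on the
  \<open>q\<close>-derivative bounds consecutive differences of \<open>f x\<^sub>k\<close>, and telescoping makes \<open>f\<close>
  \<open>M\<close>-Lipschitz on the grid. Hence the error is at most \<open>M\<close> times the weighted mean of
  \<open>\<bar>x\<^sub>m - x\<^sub>k\<bar>\<close>, which is a sum of geometric series.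
\<close>

text \<open>The triangle inequality adds up the one-step bounds from the smaller index to the
  larger. They also force \<open>v\<close> to be decreasing, so the absolute value on the right
  covers both orders of \<open>m\<close> and \<open>n\<close>.\<close>

lemma abs_diff_le_of_Suc:
  fixes u v :: "nat \<Rightarrow> real"
  assumes "\<And>k. \<bar>u k - u (Suc k)\<bar> \<le> v k - v (Suc k)"
  shows "\<bar>u m - u n\<bar> \<le> \<bar>v m - v n\<bar>"
proof -
  have le: "\<bar>u i - u j\<bar> \<le> v i - v j" if "i \<le> j" for i j
    using that
  proof (induction j rule: dec_induct)
    case (step j)
    with assms[of j] show ?case by linarith
  qed simp
  show ?thesis
    using le[of m n] le[of n m] by (cases m n rule: le_cases) auto
qed

text \<open>As \<open>q ^ k\<close> decreases in \<open>k\<close>, the difference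
  \<open>q ^ m - q ^ k\<close> changes sign only at \<open>k = m\<close>. With \<open>d\<close> the
  signed terms (up to the factor \<open>1 - q\<close>) and \<open>e\<close> their tail from
  \<open>m\<close> on, \<open>2 * e k - d k\<close> flips the sign exactly for
  \<open>k < m\<close>.\<close>

lemma sums_weighted_abs_diff_power:
  fixes q :: real
  assumes "0 < q" "q < 1"
  shows "(\<lambda>k. (1 - q) * q ^ k * \<bar>q ^ m - q ^ k\<bar>)
    sums ((1 + 2 * q ^ (2 * m + 1)) / (1 + q) - q ^ m)"
proof -
  define d where "d k = q ^ m * q ^ k - (q\<^sup>2) ^ k" for k
  define e where "e k = (if m \<le> k then d k else 0)" for k
  have q2: "norm (q\<^sup>2) < 1"
    using assms by (simp add: abs_square_less_1)
  have geom: "(\<lambda>k. q ^ k) sums (1 / (1 - q))" "(\<lambda>k. (q\<^sup>2) ^ k) sums (1 / (1 - q\<^sup>2))"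
    using assms q2 by (auto intro!: geometric_sums)
  have d: "d sums (q ^ m * (1 / (1 - q)) - 1 / (1 - q\<^sup>2))"
    unfolding d_def by (intro sums_diff sums_mult geom)
  \<comment> \<open>Shifting the index of the tail by \<open>m\<close> pulls out the factor
    \<open>q ^ (2 * m)\<close>; the terms of \<open>e\<close> below \<open>m\<close> are zero, so
    undoing the shift keeps the sum.\<close>
  have "(\<lambda>k. q ^ (2 * m) * (q ^ k - (q\<^sup>2) ^ k))
      sums (q ^ (2 * m) * (1 / (1 - q) - 1 / (1 - q\<^sup>2)))"
    by (intro sums_mult sums_diff geom)
  also have "(\<lambda>k. q ^ (2 * m) * (q ^ k - (q\<^sup>2) ^ k)) = (\<lambda>k. e (k + m))"
    by (auto simp: e_def d_def algebra_simps power_add power2_eq_square power_mult_distrib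
        mult_2 mult_2_right)
  finally have e: "e sums (q ^ (2 * m) * (1 / (1 - q) - 1 / (1 - q\<^sup>2)))"
    by (subst (asm) sums_zero_iff_shift) (auto simp: e_def)
  have "(\<lambda>k. (1 - q) * (2 * e k - d k)) sums ((1 - q) *
      (2 * (q ^ (2 * m) * (1 / (1 - q) - 1 / (1 - q\<^sup>2)))
        - (q ^ m * (1 / (1 - q)) - 1 / (1 - q\<^sup>2))))"
    by (intro sums_mult sums_diff e d)
  also have "(\<lambda>k. (1 - q) * (2 * e k - d k)) = (\<lambda>k. (1 - q) * q ^ k * \<bar>q ^ m - q ^ k\<bar>)"
  proof
    fix k
    have "q ^ k \<le> q ^ m" if "m \<le> k"
      using that assms by (intro power_decreasing) auto
    moreover have "q ^ m \<le> q ^ k" if "\<not> m \<le> k"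
      using that assms by (intro power_decreasing) auto
    ultimately have "\<bar>q ^ m - q ^ k\<bar> = (if m \<le> k then q ^ m - q ^ k else q ^ k - q ^ m)"
      by auto
    thus "(1 - q) * (2 * e k - d k) = (1 - q) * q ^ k * \<bar>q ^ m - q ^ k\<bar>"
      by (simp add: e_def d_def algebra_simps power2_eq_square power_mult_distrib)
  qed
  also have "(1 - q) * (2 * (q ^ (2 * m) * (1 / (1 - q) - 1 / (1 - q\<^sup>2)))
        - (q ^ m * (1 / (1 - q)) - 1 / (1 - q\<^sup>2)))
      = (1 + 2 * q ^ (2 * m + 1)) / (1 + q) - q ^ m"
  proof -
    have "1 - q\<^sup>2 = (1 - q) * (1 + q)"
      by (simp add: algebra_simps power2_eq_square)
    with assms show ?thesis
      by (simp add: divide_simps)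
  qed
  finally show ?thesis .
qed

text \<open>The map \<open>x \<mapsto> a + q * (x - a)\<close> sends each grid point to the next, so
  \<open>q_deriv\<close> at a grid point is the difference quotient over one grid step.\<close>

lemma abs_q_grid_diff_le:
  assumes "a < b" "0 < q" "q < 1" "0 \<le> M"
    and bound: "\<And>t. t \<in> {a<..b} \<Longrightarrow> \<bar>q_deriv q a f t\<bar> \<le> M"
  shows "\<bar>f (a + q ^ m * (b - a)) - f (a + q ^ k * (b - a))\<bar>
    \<le> (b - a) * M * \<bar>q ^ m - q ^ k\<bar>"
proof -
  let ?u = "\<lambda>k. f (a + q ^ k * (b - a))" and ?v = "\<lambda>k. (b - a) * M * q ^ k"
  have "\<bar>?u k - ?u (Suc k)\<bar> \<le> ?v k - ?v (Suc k)" for k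
  proof -
    let ?s = "(1 - q) * (q ^ k * (b - a))"
    have "q ^ k * (b - a) \<le> 1 * (b - a)"
      using assms by (intro mult_right_mono power_le_one) auto
    moreover have "0 < q ^ k * (b - a)"
      using assms by simp
    ultimately have "a + q ^ k * (b - a) \<in> {a<..b}"
      by (simp del: zero_less_mult_iff)
    from bound[OF this] have "\<bar>(?u k - ?u (Suc k)) / ?s\<bar> \<le> M"
      by (simp add: q_deriv_def mult.assoc)
    moreover have "0 < ?s"
      using assms by simp
    ultimately have "\<bar>?u k - ?u (Suc k)\<bar> \<le> M * ?s"
      by (simp add: abs_divide pos_divide_le_eq del: mult_pos_pos)
    thus ?thesis
      by (simp add: algebra_simps)
  qed
  hence "\<bar>?u m - ?u k\<bar> \<le> \<bar>?v m - ?v k\<bar>"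
    by (rule abs_diff_le_of_Suc)
  also have "\<dots> = (b - a) * M * \<bar>q ^ m - q ^ k\<bar>"
    using assms by (simp add: abs_mult flip: right_diff_distrib)
  finally show ?thesis .
qed

theorem theorem8:
  fixes a b q :: real and f :: "real \<Rightarrow> real" and m :: nat
  assumes "a < b" and "0 < q" and "q < 1"
    and "q_integrable q a b f"
  shows "ereal \<bar>f (a + q ^ m * (b - a)) - 1 / (b - a) * q_integral q a b f\<bar>
    \<le> ereal ((b - a) * ((1 + 2 * q ^ (2 * m + 1)) / (1 + q) - q ^ m))
      * sup_norm_on {a<..b} (q_deriv q a f)"
proof -
  define u where "u k = f (a + q ^ k * (b - a))" for k
  define c where "c = (1 + 2 * q ^ (2 * m + 1)) / (1 + q) - q ^ m"
  define S where "S = sup_norm_on {a<..b} (q_deriv q a f)"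
  have c: "(\<lambda>k. (1 - q) * q ^ k * \<bar>q ^ m - q ^ k\<bar>) sums c"
    unfolding c_def using assms by (intro sums_weighted_abs_diff_power)
  have upper: "ereal \<bar>q_deriv q a f t\<bar> \<le> S" if "t \<in> {a<..b}" for t
    unfolding S_def sup_norm_on_def using that by (rule SUP_upper)
  \<comment> \<open>The interval contains \<open>b\<close>, so the supremum is not the
    \<open>-\<infinity>\<close> of an empty set.\<close>
  have "0 \<le> S"
    using upper[of b] assms(1) by (auto intro: order.trans[rotated])
  then consider M where "S = ereal M" "0 \<le> M" | "S = \<infinity>"
    by (cases S) auto
  hence "ereal \<bar>u m - 1 / (b - a) * q_integral q a b f\<bar> \<le> ereal ((b - a) * c) * S"
  proof cases
    case (1 M)
    have bound: "\<bar>q_deriv q a f t\<bar> \<le> M" if "t \<in> {a<..b}" for t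
      using upper[OF that] 1 by simp
    have "(\<lambda>k. q ^ k * u k) sums (\<Sum>k. q ^ k * u k)"
      using assms(4) by (simp add: q_integrable_def u_def summable_sums)
    \<comment> \<open>Writing \<open>u m\<close> as a weighted mean of itself turns the error into a
      single series.\<close>
    moreover have "(\<lambda>k. q ^ k * u m) sums (1 / (1 - q) * u m)"
      using assms by (intro sums_mult2 geometric_sums) auto
    ultimately have "(\<lambda>k. (1 - q) * (q ^ k * u m - q ^ k * u k))
        sums ((1 - q) * (1 / (1 - q) * u m - (\<Sum>k. q ^ k * u k)))"
      by (intro sums_mult sums_diff)
    also have "(1 - q) * (1 / (1 - q) * u m - (\<Sum>k. q ^ k * u k))
        = u m - 1 / (b - a) * q_integral q a b f"
      using assms by (simp add: q_integral_def u_def field_simps)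
    finally have err: "(\<lambda>k. (1 - q) * (q ^ k * u m - q ^ k * u k))
        sums (u m - 1 / (b - a) * q_integral q a b f)" .
    have dom: "(\<lambda>k. (b - a) * M * ((1 - q) * q ^ k * \<bar>q ^ m - q ^ k\<bar>)) sums ((b - a) * M * c)"
      by (intro sums_mult c)
    have "norm ((1 - q) * (q ^ k * u m - q ^ k * u k))
        \<le> (b - a) * M * ((1 - q) * q ^ k * \<bar>q ^ m - q ^ k\<bar>)" for k
    proof -
      have "norm ((1 - q) * (q ^ k * u m - q ^ k * u k)) = (1 - q) * q ^ k * \<bar>u m - u k\<bar>"
        using assms by (simp add: abs_mult flip: right_diff_distrib)
      also have "\<dots> \<le> (1 - q) * q ^ k * ((b - a) * M * \<bar>q ^ m - q ^ k\<bar>)"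
        unfolding u_def using assms 1 bound by (intro mult_left_mono abs_q_grid_diff_le) auto
      finally show ?thesis
        by (simp add: mult_ac)
    qed
    hence "norm (\<Sum>k. (1 - q) * (q ^ k * u m - q ^ k * u k))
        \<le> (\<Sum>k. (b - a) * M * ((1 - q) * q ^ k * \<bar>q ^ m - q ^ k\<bar>))"
      using dom by (intro norm_suminf_le) (auto simp: sums_iff)
    with err dom show ?thesis
      by (simp add: 1 sums_iff mult_ac)
  next
    case 2
    \<comment> \<open>Here \<open>c = 0\<close> has to be excluded, since \<open>0 * \<infinity> = 0\<close> in \<open>ereal\<close>.\<close>
    have "0 < (\<Sum>k. (1 - q) * q ^ k * \<bar>q ^ m - q ^ k\<bar>)"
      \<comment> \<open>The term at \<open>m\<close> vanishes; the one at \<open>Suc m\<close> is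
        positive because \<open>q ^ Suc m < q ^ m\<close>.\<close>
      using c assms by (intro suminf_pos2[where i = "Suc m"]) (auto simp: sums_iff)
    hence "0 < (b - a) * c"
      using c assms by (simp add: sums_iff)
    thus ?thesis
      by (auto simp: 2)
  qed
  thus ?thesis
    by (simp add: u_def c_def S_def)
qed

end
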